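(* Let $\alpha,\beta>-1$, $N\ge1$, and $p,\gamma_+,\gamma_-\in\mathbb N_0$ with $d=2p+\gamma_++\gamma_-\ge1$. Put $\chi(x)=x^{2p}(1-x)^{\gamma_+}(1+x)^{\gamma_-}$ and $X=\operatorname{span}\{P_N^{(\alpha,\beta)},\ldots,P_{N+d-1}^{(\alpha,\beta)}\}$. For every $k=0,\ldots,N-1$ there exists a unique polynomial $\widetilde C_k\in X$ such that $$\left(\widetilde C_k-P_k^{(\alpha,\beta)}\right)^{(r)}(0)=0,\quad r=0,\ldots,2p-1,$$ $$\left(\widetilde C_k-P_k^{(\alpha,\beta)}\right)^{(r)}(1)=0,\quad r=0,\ldots,\gamma_+-1,$$ $$\left(\widetilde C_k-P_k^{(\alpha,\beta)}\right)^{(r)}(-1)=0,\quad r=0,\ldots,\gamma_--1$$ (conditions with an empty range of $r$ are absent). The quotient $$\widetilde{\mathcal Q}_k(x)=\frac{\widetilde C_k(x)-P_k^{(\alpha,\beta)}(x)}{\chi(x)},\quad k=0,\ldots,N-1,$$ is therefore a polynomial belonging to $\Pi_{N-1}$. Moreover, the families $$\mathcal B_1=\{\widetilde{\mathcal Q}_0,\ldots,\widetilde{\mathcal Q}_{N-1}\},\qquad \mathcal B_2=\{1,\widetilde{\mathcal Q}_1,\ldots,\widetilde{\mathcal Q}_{N-1}\}$$ are bases of $\Pi_{N-1}$.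
   Context: $\Pi_{N-1}$ is the space of real polynomials of degree at most $N-1$. $P_n^{(\alpha,\beta)}$ is the classical Jacobi polynomial of degree $n$, orthogonal with respect to $(1-x)^\alpha(1+x)^\beta$ on $(-1,1)$ and normalized by $P_n^{(\alpha,\beta)}(1)=\frac{(\alpha+1)_n}{n!}$, where $(s)_n$ is the rising factorial. $f^{(r)}$ denotes the $r$-th derivative. *)

theory Defs
  imports "HOL-Analysis.Analysis" "HOL-Computational_Algebra.Polynomial"
begin

text \<open>
  The type \<^typ>\<open>real poly\<close> is not an instance of the class \<^class>\<open>real_vector\<close>, so span and
  linear independence are taken from the locale of vector spaces, with scalar multiplication
  \<^const>\<open>smult\<close>.
\<close>

global_interpretation rpoly: vector_space "smult :: real \<Rightarrow> real poly \<Rightarrow> real poly"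
  by unfold_locales (simp_all add: smult_add_right smult_add_left)

definition poly_space :: "nat \<Rightarrow> real poly set" where
  "poly_space n = {q. degree q \<le> n}"

text \<open>Indexed families: injectivity excludes repeated members.\<close>

definition basis_family :: "'i set \<Rightarrow> ('i \<Rightarrow> real poly) \<Rightarrow> real poly set \<Rightarrow> bool" where
  "basis_family I f V \<longleftrightarrow>
     inj_on f I \<and> rpoly.independent (f ` I) \<and> rpoly.span (f ` I) = V"

definition jacobi_inner :: "real \<Rightarrow> real \<Rightarrow> real poly \<Rightarrow> real poly \<Rightarrow> real" where
  "jacobi_inner \<alpha> \<beta> p q =
     (LINT x:{-1<..<1}|lborel. (1 - x) powr \<alpha> * (1 + x) powr \<beta> * poly p x * poly q x)"

definition is_jacobi :: "real \<Rightarrow> real \<Rightarrow> nat \<Rightarrow> real poly \<Rightarrow> bool" where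
  "is_jacobi \<alpha> \<beta> n P \<longleftrightarrow>
     degree P = n \<and>
     (\<forall>q. degree q < n \<longrightarrow> jacobi_inner \<alpha> \<beta> P q = 0) \<and>
     poly P 1 = pochhammer (\<alpha> + 1) n / fact n"

text \<open>
  For \<open>\<alpha>, \<beta> > -1\<close> the description is proper, see \<open>is_jacobi_jacobi_poly\<close> below.
\<close>

definition jacobi_poly :: "real \<Rightarrow> real \<Rightarrow> nat \<Rightarrow> real poly" where
  "jacobi_poly \<alpha> \<beta> n = (THE P. is_jacobi \<alpha> \<beta> n P)"

lemma jacobi_weight_integrable:
  fixes \<alpha> \<beta> :: real
  assumes "\<alpha> > -1" "\<beta> > -1"
  shows "set_integrable lborel {-1<..<1} (\<lambda>x. (1 - x) powr \<alpha> * (1 + x) powr \<beta>)"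
proof -
  have "set_integrable lborel {0..1} (\<lambda>t. t powr (\<beta> + 1 - 1) * (1 - t) powr (\<alpha> + 1 - 1))"
    by (rule integrable_Beta) (use assms in auto)
  then have "integrable lborel (\<lambda>t. indicator {0..1} t *\<^sub>R (t powr \<beta> * (1 - t) powr \<alpha>))"
    by (simp add: set_integrable_def)
  then have "integrable lborel (\<lambda>x. indicator {0..1} (1/2 + 1/2 * x) *\<^sub>R
      ((1/2 + 1/2 * x) powr \<beta> * (1 - (1/2 + 1/2 * x)) powr \<alpha>))"
    by (rule lborel_integrable_real_affine) simp
  then have "integrable lborel (\<lambda>x. 2 powr (\<alpha> + \<beta>) * (indicator {0..1} (1/2 + 1/2 * x) *\<^sub>R
      ((1/2 + 1/2 * x) powr \<beta> * (1 - (1/2 + 1/2 * x)) powr \<alpha>)))"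
    by simp
  also have "(\<lambda>x. 2 powr (\<alpha> + \<beta>) * (indicator {0..1} (1/2 + 1/2 * x) *\<^sub>R
      ((1/2 + 1/2 * x) powr \<beta> * (1 - (1/2 + 1/2 * x)) powr \<alpha>))) =
      (\<lambda>x. indicator {-1..1} x *\<^sub>R ((1 - x) powr \<alpha> * (1 + x) powr \<beta>))"
  proof
    fix x :: real
    show "2 powr (\<alpha> + \<beta>) * (indicator {0..1} (1/2 + 1/2 * x) *\<^sub>R
      ((1/2 + 1/2 * x) powr \<beta> * (1 - (1/2 + 1/2 * x)) powr \<alpha>)) =
       indicator {-1..1} x *\<^sub>R ((1 - x) powr \<alpha> * (1 + x) powr \<beta>)"
    proof (cases "x \<in> {-1..1}")
      case True
      have "1/2 + 1/2 * x = (1 + x) / 2" "1 - (1/2 + 1/2 * x) = (1 - x) / 2"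
        by (simp_all add: field_simps)
      moreover have "((1 + x) / 2) powr \<beta> = (1 + x) powr \<beta> / 2 powr \<beta>"
        "((1 - x) / 2) powr \<alpha> = (1 - x) powr \<alpha> / 2 powr \<alpha>"
        using True by (simp_all add: powr_divide)
      ultimately have "(1/2 + 1/2 * x) powr \<beta> * (1 - (1/2 + 1/2 * x)) powr \<alpha> =
          (1 - x) powr \<alpha> * (1 + x) powr \<beta> / 2 powr (\<alpha> + \<beta>)"
        by (simp only: powr_add) (simp add: mult.commute)
      moreover have "1/2 + 1/2 * x \<in> {0..1}" using True by auto
      ultimately show ?thesis
        using True by (simp only: indicator_simps) simp
    qed (auto simp: indicator_def)
  qed
  finally have "set_integrable lborel {-1..1} (\<lambda>x. (1 - x) powr \<alpha> * (1 + x) powr \<beta>)"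
    by (simp add: set_integrable_def)
  then show ?thesis
    by (rule set_integrable_subset) auto
qed

lemma jacobi_weight_poly_integrable:
  fixes \<alpha> \<beta> :: real and q :: "real poly"
  assumes "\<alpha> > -1" "\<beta> > -1"
  shows "set_integrable lborel {-1<..<1} (\<lambda>x. (1 - x) powr \<alpha> * (1 + x) powr \<beta> * poly q x)"
proof -
  have "bounded (poly q ` {-1..1})"
    by (intro compact_imp_bounded compact_continuous_image continuous_intros) auto
  then obtain B where B: "\<And>x. x \<in> {-1..1} \<Longrightarrow> \<bar>poly q x\<bar> \<le> B"
    unfolding bounded_iff by (metis image_eqI real_norm_def)
  have "set_integrable lborel {-1<..<1} (\<lambda>x. B * ((1 - x) powr \<alpha> * (1 + x) powr \<beta>))"
    using jacobi_weight_integrable[OF assms] by simp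
  then show ?thesis
  proof (rule set_integrable_bound)
    show "set_borel_measurable lborel {-1<..<1}
        (\<lambda>x. (1 - x) powr \<alpha> * (1 + x) powr \<beta> * poly q x)"
      unfolding set_borel_measurable_def
      by (intro borel_measurable_scaleR borel_measurable_times)
        (auto intro!: borel_measurable_continuous_onI continuous_intros)
    show "AE x in lborel. x \<in> {-1<..<1} \<longrightarrow>
        norm ((1 - x) powr \<alpha> * (1 + x) powr \<beta> * poly q x)
          \<le> norm (B * ((1 - x) powr \<alpha> * (1 + x) powr \<beta>))"
    proof (intro AE_I2 impI)
      fix x :: real assume x: "x \<in> {-1<..<1}"
      then have "\<bar>poly q x\<bar> \<le> \<bar>B\<bar>" using B[of x] by auto
      then show "norm ((1 - x) powr \<alpha> * (1 + x) powr \<beta> * poly q x)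
          \<le> norm (B * ((1 - x) powr \<alpha> * (1 + x) powr \<beta>))"
        by (simp add: abs_mult mult_right_mono mult.commute[of "\<bar>B\<bar>"] mult_left_mono)
    qed
  qed
qed

lemma jacobi_inner_eq:
  "jacobi_inner \<alpha> \<beta> p q =
     (LINT x:{-1<..<1}|lborel. (1 - x) powr \<alpha> * (1 + x) powr \<beta> * poly (p * q) x)"
  by (simp add: jacobi_inner_def mult.assoc)

lemma jacobi_inner_commute: "jacobi_inner \<alpha> \<beta> p q = jacobi_inner \<alpha> \<beta> q p"
  by (simp add: jacobi_inner_eq mult.commute)

lemma jacobi_inner_smult_left: "jacobi_inner \<alpha> \<beta> (smult c p) q = c * jacobi_inner \<alpha> \<beta> p q"
proof -
  have "jacobi_inner \<alpha> \<beta> (smult c p) q =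
     (LINT x:{-1<..<1}|lborel. c * ((1 - x) powr \<alpha> * (1 + x) powr \<beta> * poly (p * q) x))"
    by (simp add: jacobi_inner_eq algebra_simps)
  then show ?thesis by (simp only: set_integral_mult_right jacobi_inner_eq)
qed

lemma jacobi_inner_add_left:
  assumes "\<alpha> > -1" "\<beta> > -1"
  shows "jacobi_inner \<alpha> \<beta> (p + p') q = jacobi_inner \<alpha> \<beta> p q + jacobi_inner \<alpha> \<beta> p' q"
  unfolding jacobi_inner_eq
  by (subst set_integral_add(2)[symmetric])
    (simp_all only: jacobi_weight_poly_integrable[OF assms] distrib_right poly_add distrib_left)

lemma jacobi_inner_diff_left:
  assumes "\<alpha> > -1" "\<beta> > -1"
  shows "jacobi_inner \<alpha> \<beta> (p - p') q = jacobi_inner \<alpha> \<beta> p q - jacobi_inner \<alpha> \<beta> p' q"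
  using jacobi_inner_add_left[OF assms, of "p - p'" p' q] by simp

lemma jacobi_weight_integral_eq_0:
  fixes h :: "real poly"
  assumes "\<alpha> > -1" "\<beta> > -1" "\<And>x. x \<in> {-1<..<1} \<Longrightarrow> poly h x \<ge> 0"
    and "(LINT x:{-1<..<1}|lborel. (1 - x) powr \<alpha> * (1 + x) powr \<beta> * poly h x) = 0"
  shows "h = 0"
proof (rule ccontr)
  assume "h \<noteq> 0"
  let ?f = "\<lambda>x::real. indicator {-1<..<1} x *\<^sub>R ((1 - x) powr \<alpha> * (1 + x) powr \<beta> * poly h x)"
  have "AE x in lborel. ?f x = 0"
  proof (subst integral_nonneg_eq_0_iff_AE[symmetric])
    show "integrable lborel ?f"
      using jacobi_weight_poly_integrable[OF assms(1,2), of h] by (simp add: set_integrable_def)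
    show "AE x in lborel. 0 \<le> ?f x"
      by (rule AE_I2) (use assms(3) in \<open>auto simp: indicator_def\<close>)
    show "integral\<^sup>L lborel ?f = 0"
      using assms(4) by (simp add: set_lebesgue_integral_def)
  qed
  moreover have "AE x in lborel. x \<notin> {x. poly h x = 0}"
    by (intro AE_not_in countable_imp_null_set_lborel countable_finite poly_roots_finite \<open>h \<noteq> 0\<close>)
  ultimately have "AE x in lborel. x \<notin> {-1<..<1::real}"
    by eventually_elim (auto simp: indicator_def)
  then have "{-1<..<1::real} \<in> null_sets lborel"
    by (subst (asm) AE_iff_null_sets[symmetric]) auto
  then show False
    by (auto dest: null_setsD1)
qed

lemma jacobi_inner_self_eq_0:
  assumes "\<alpha> > -1" "\<beta> > -1" "jacobi_inner \<alpha> \<beta> q q = 0"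
  shows "q = 0"
  using jacobi_weight_integral_eq_0[of \<alpha> \<beta> "q * q"] assms by (simp add: jacobi_inner_eq)

lemma jacobi_orthogonal_at_1:
  assumes "\<alpha> > -1" "\<beta> > -1" "P \<noteq> 0"
    and orth: "\<And>q. degree q < degree P \<Longrightarrow> jacobi_inner \<alpha> \<beta> P q = 0"
  shows "poly P 1 \<noteq> 0"
proof
  assume "poly P 1 = 0"
  then have "[:-1, 1:] dvd P" by (simp add: poly_eq_0_iff_dvd)
  then obtain q where q: "P = [:-1, 1:] * q" by (elim dvdE)
  have "q \<noteq> 0" using q assms(3) by auto
  then have "degree P = Suc (degree q)" using q by (simp add: degree_mult_eq del: mult_pCons_left)
  then have "jacobi_inner \<alpha> \<beta> (smult (-1) P) q = 0"
    unfolding jacobi_inner_smult_left using orth[of q] by simp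
  moreover have "smult (-1) P * q = [:1, -1:] * (q * q)"
    by (simp add: q algebra_simps)
  ultimately have "(LINT x:{-1<..<1}|lborel.
      (1 - x) powr \<alpha> * (1 + x) powr \<beta> * poly ([:1, -1:] * (q * q)) x) = 0"
    by (simp only: jacobi_inner_eq)
  moreover have "poly ([:1, -1:] * (q * q)) x \<ge> 0" if "x \<in> {-1<..<1}" for x
  proof -
    have "poly ([:1, -1:] * (q * q)) x = (1 - x) * (poly q x * poly q x)"
      by (simp only: poly_mult) simp
    then show ?thesis using that by simp
  qed
  ultimately have "[:1, -1:] * (q * q) = 0"
    using jacobi_weight_integral_eq_0[OF assms(1,2)] by blast
  then show False using \<open>q \<noteq> 0\<close> by (simp del: mult_pCons_left)
qed

lemma jacobi_orthogonal_exists: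
  assumes "\<alpha> > -1" "\<beta> > -1"
  shows "\<exists>P. degree P = n \<and> P \<noteq> 0 \<and> (\<forall>q. degree q < n \<longrightarrow> jacobi_inner \<alpha> \<beta> P q = 0)"
proof -
  text \<open>Orthogonal projection of \<open>x^n\<close>, one degree at a time.\<close>
  have "\<exists>P. degree P = n \<and> P \<noteq> 0 \<and> (\<forall>q. degree q < m \<longrightarrow> jacobi_inner \<alpha> \<beta> P q = 0)"
    if "m \<le> n" for m n
    using that
  proof (induction m arbitrary: n)
    case 0
    then show ?case by (intro exI[of _ "monom 1 n"]) (simp add: degree_monom_eq)
  next
    case (Suc m)
    obtain P where P: "degree P = n" "P \<noteq> 0" "\<And>q. degree q < m \<Longrightarrow> jacobi_inner \<alpha> \<beta> P q = 0"
      using Suc.IH[of n] Suc.prems by auto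
    obtain R where R: "degree R = m" "R \<noteq> 0" "\<And>q. degree q < m \<Longrightarrow> jacobi_inner \<alpha> \<beta> R q = 0"
      using Suc.IH[of m] by auto
    define c where "c = jacobi_inner \<alpha> \<beta> P R / jacobi_inner \<alpha> \<beta> R R"
    define S where "S = P - smult c R"
    have RR: "jacobi_inner \<alpha> \<beta> R R \<noteq> 0"
      using jacobi_inner_self_eq_0[OF assms] R(2) by blast
    have inner_S: "jacobi_inner \<alpha> \<beta> S q = jacobi_inner \<alpha> \<beta> P q - c * jacobi_inner \<alpha> \<beta> R q" for q
      by (simp add: S_def jacobi_inner_diff_left[OF assms] jacobi_inner_smult_left)
    have SR: "jacobi_inner \<alpha> \<beta> S R = 0"
      using RR by (simp add: inner_S c_def)
    have S_low: "jacobi_inner \<alpha> \<beta> S q = 0" if "degree q < m" for q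
      using that P(3) R(3) by (simp add: inner_S)
    have "coeff S n = lead_coeff P"
      using P(1) R(1) Suc.prems by (simp add: S_def coeff_eq_0)
    moreover have "degree S \<le> n"
      using P(1) R(1) Suc.prems unfolding S_def
      by (intro degree_diff_le order_trans[OF degree_smult_le]) auto
    ultimately have "degree S = n" "S \<noteq> 0"
      using P(2) le_degree[of S n] by (auto simp: le_antisym)
    moreover have "jacobi_inner \<alpha> \<beta> S q = 0" if q: "degree q < Suc m" for q
    proof -
      define e where "e = coeff q m / lead_coeff R"
      define u where "u = q - smult e R"
      have "jacobi_inner \<alpha> \<beta> S u = 0"
      proof (cases "u = 0")
        case True
        then show ?thesis by (simp add: jacobi_inner_def)
      next
        case False
        have "coeff u i = 0" if "m \<le> i" for i
          using that R(1,2) q by (cases "i = m") (auto simp: u_def e_def coeff_eq_0)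
        then have "degree u < m"
          using False by (metis leading_coeff_0_iff not_le)
        then show ?thesis by (rule S_low)
      qed
      moreover have "q = u + smult e R" by (simp add: u_def)
      ultimately show ?thesis
        using SR by (metis jacobi_inner_add_left[OF assms] jacobi_inner_commute
          jacobi_inner_smult_left add_0 mult_zero_right)
    qed
    ultimately show ?case by blast
  qed
  from this[of n n] show ?thesis by simp
qed

lemma is_jacobi_unique:
  assumes "\<alpha> > -1" "\<beta> > -1" "is_jacobi \<alpha> \<beta> n P" "is_jacobi \<alpha> \<beta> n Q"
  shows "P = Q"
proof (cases "n = 0")
  case True
  then obtain a b where "P = [:a:]" "Q = [:b:]"
    using assms(3,4) by (auto simp: is_jacobi_def elim!: degree_eq_zeroE)
  then show ?thesis using assms(3,4) by (simp add: is_jacobi_def)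
next
  case False
  note P = assms(3)[unfolded is_jacobi_def] and Q = assms(4)[unfolded is_jacobi_def]
  have "Q \<noteq> 0" using Q False by auto
  define c where "c = lead_coeff P / lead_coeff Q"
  define R where "R = P - smult c Q"
  have "R = 0"
  proof (rule ccontr)
    assume "R \<noteq> 0"
    have "coeff R i = 0" if "n \<le> i" for i
    proof (cases "i = n")
      case True
      then have "coeff R i = lead_coeff P - c * lead_coeff Q"
        using P Q by (simp add: R_def)
      then show ?thesis using \<open>Q \<noteq> 0\<close> by (simp add: c_def)
    next
      case False
      then show ?thesis using that P Q by (simp add: R_def coeff_eq_0)
    qed
    then have "degree R < n"
      using \<open>R \<noteq> 0\<close> by (metis leading_coeff_0_iff not_le)
    then have "jacobi_inner \<alpha> \<beta> P R = 0" "jacobi_inner \<alpha> \<beta> Q R = 0"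
      using P Q by auto
    then have "jacobi_inner \<alpha> \<beta> R R = 0"
      unfolding R_def by (simp add: jacobi_inner_diff_left[OF assms(1,2)] jacobi_inner_smult_left)
    with \<open>R \<noteq> 0\<close> show False
      using jacobi_inner_self_eq_0[OF assms(1,2)] by blast
  qed
  then have eq: "P = smult c Q" by (simp add: R_def)
  have "poly Q 1 \<noteq> 0"
    using Q \<open>Q \<noteq> 0\<close> by (intro jacobi_orthogonal_at_1[OF assms(1,2)]) auto
  moreover have "c * poly Q 1 = poly Q 1"
    using P Q eq by (metis poly_smult)
  ultimately show ?thesis using eq by simp
qed

lemma is_jacobi_exists:
  assumes "\<alpha> > -1" "\<beta> > -1"
  shows "\<exists>P. is_jacobi \<alpha> \<beta> n P"
proof -
  obtain P where P: "degree P = n" "P \<noteq> 0" "\<And>q. degree q < n \<Longrightarrow> jacobi_inner \<alpha> \<beta> P q = 0"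
    using jacobi_orthogonal_exists[OF assms] by blast
  have P1: "poly P 1 \<noteq> 0"
    using P by (intro jacobi_orthogonal_at_1[OF assms]) auto
  have poch: "pochhammer (\<alpha> + 1) n \<noteq> 0"
    using assms(1) pochhammer_pos[of "\<alpha> + 1" n] by simp
  define c where "c = pochhammer (\<alpha> + 1) n / fact n / poly P 1"
  have "is_jacobi \<alpha> \<beta> n (smult c P)"
    using P P1 poch by (simp add: is_jacobi_def c_def jacobi_inner_smult_left)
  then show ?thesis ..
qed

lemma is_jacobi_jacobi_poly:
  assumes "\<alpha> > -1" "\<beta> > -1"
  shows "is_jacobi \<alpha> \<beta> n (jacobi_poly \<alpha> \<beta> n)"
  unfolding jacobi_poly_def
  using is_jacobi_exists[OF assms] is_jacobi_unique[OF assms] by (blast intro: theI)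

definition chi :: "nat \<Rightarrow> nat \<Rightarrow> nat \<Rightarrow> real poly" where
  "chi p \<gamma>p \<gamma>m = [:0, 1:] ^ (2 * p) * [:1, -1:] ^ \<gamma>p * [:1, 1:] ^ \<gamma>m"

definition jacobi_span :: "real \<Rightarrow> real \<Rightarrow> nat \<Rightarrow> nat \<Rightarrow> real poly set" where
  "jacobi_span \<alpha> \<beta> N d = rpoly.span (jacobi_poly \<alpha> \<beta> ` {N..N + d - 1})"

definition is_C_tilde ::
  "real \<Rightarrow> real \<Rightarrow> nat \<Rightarrow> nat \<Rightarrow> nat \<Rightarrow> nat \<Rightarrow> nat \<Rightarrow> real poly \<Rightarrow> bool" where
  "is_C_tilde \<alpha> \<beta> N p \<gamma>p \<gamma>m k C \<longleftrightarrow>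
     C \<in> jacobi_span \<alpha> \<beta> N (2 * p + \<gamma>p + \<gamma>m) \<and>
     (\<forall>r<2 * p. poly ((pderiv ^^ r) (C - jacobi_poly \<alpha> \<beta> k)) 0 = 0) \<and>
     (\<forall>r<\<gamma>p. poly ((pderiv ^^ r) (C - jacobi_poly \<alpha> \<beta> k)) 1 = 0) \<and>
     (\<forall>r<\<gamma>m. poly ((pderiv ^^ r) (C - jacobi_poly \<alpha> \<beta> k)) (-1) = 0)"

definition C_tilde ::
  "real \<Rightarrow> real \<Rightarrow> nat \<Rightarrow> nat \<Rightarrow> nat \<Rightarrow> nat \<Rightarrow> nat \<Rightarrow> real poly" where
  "C_tilde \<alpha> \<beta> N p \<gamma>p \<gamma>m k = (THE C. is_C_tilde \<alpha> \<beta> N p \<gamma>p \<gamma>m k C)"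

text \<open>
  On \<^typ>\<open>real poly\<close>, \<^const>\<open>divide\<close> is the true quotient only when the division is exact.
\<close>

definition Q_tilde ::
  "real \<Rightarrow> real \<Rightarrow> nat \<Rightarrow> nat \<Rightarrow> nat \<Rightarrow> nat \<Rightarrow> nat \<Rightarrow> real poly" where
  "Q_tilde \<alpha> \<beta> N p \<gamma>p \<gamma>m k =
     (C_tilde \<alpha> \<beta> N p \<gamma>p \<gamma>m k - jacobi_poly \<alpha> \<beta> k) div chi p \<gamma>p \<gamma>m"

end

theory Submission
  imports Defs
begin

text \<open>
  Write \<open>\<langle>f, g\<rangle>\<close> for the Jacobi inner product, \<open>\<Pi>\<close> for the polynomials of degree below \<open>N\<close>
  and \<open>P\<^sub>k\<close> for the Jacobi polynomials. The interpolation conditions say precisely that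
  \<open>\<chi>\<close> divides \<open>C - P\<^sub>k\<close> (\<open>chi_dvd_iff\<close>), and every element of \<open>X\<close> is orthogonal to \<open>\<Pi>\<close>. Since the
  even power of \<open>x\<close> makes \<open>\<chi>\<close> nonnegative on \<open>(-1,1)\<close>, the form \<open>(q, r) \<mapsto> \<langle>\<chi> q, r\<rangle>\<close> is positive
  definite on polynomials (\<open>weighted_inner_definite\<close>); everything follows from this.

  A polynomial \<open>\<chi> q \<in> X\<close> with \<open>q \<in> \<Pi>\<close> satisfies \<open>\<langle>\<chi> q, q\<rangle> = 0\<close>, so \<open>q = 0\<close>. Hence \<open>X\<close> and
  \<open>\<chi> \<Pi>\<close> meet only in \<open>0\<close>, and counting dimensions, the polynomials of degree below \<open>N + d\<close> are
  the direct sum of \<open>X\<close> and \<open>\<chi> \<Pi>\<close> (\<open>jacobi_span_decomposition\<close>). The component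
  of \<open>P\<^sub>k\<close> in \<open>X\<close> is the required polynomial, and the component in \<open>\<chi> \<Pi>\<close> is \<open>-\<chi>\<close> times its quotient.

  For the quotients, orthogonality of \<open>X\<close> to \<open>\<Pi>\<close> gives
  \<open>\<langle>\<chi> Q\<^sub>k, P\<^sub>j\<rangle> = -\<langle>P\<^sub>k, P\<^sub>j\<rangle>\<close> for \<open>j, k < N\<close>, a diagonal matrix without zeros on the
  diagonal. Replacing \<open>Q\<^sub>0\<close> by \<open>1\<close> changes only the entries \<open>\<langle>\<chi>, P\<^sub>j\<rangle>\<close> for \<open>k = 0\<close>; the matrix remains
  triangular, with the nonzero diagonal entry \<open>\<langle>\<chi>, 1\<rangle>\<close>. So both families are linearly independent,
  and they have as many members as the dimension of \<open>\<Pi>\<close> (\<open>basis_family_triangular\<close>).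
\<close>

section \<open>Bases of polynomial spaces\<close>

lemma subspace_poly_space: "rpoly.subspace (poly_space n)"
  unfolding rpoly.subspace_def poly_space_def
  by (auto intro: degree_add_le order_trans[OF degree_smult_le])

lemma poly_space_subset_span_monom: "poly_space n \<subseteq> rpoly.span (monom 1 ` {..n})"
proof
  fix q assume "q \<in> poly_space n"
  then have "q = (\<Sum>i\<le>n. smult (coeff q i) (monom 1 i))"
    by (simp add: poly_space_def smult_monom poly_as_sum_of_monoms')
  also have "\<dots> \<in> rpoly.span (monom 1 ` {..n})"
    by (intro rpoly.span_sum rpoly.span_scale rpoly.span_base) auto
  finally show "q \<in> rpoly.span (monom 1 ` {..n})" .
qed

text \<open>
  The spanning part holds because a polynomial outside the span would extend the family to an
  independent set that is larger than the spanning set of monomials.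
\<close>

lemma basis_familyI:
  assumes n: "0 < n" and f: "\<And>i. i < n \<Longrightarrow> f i \<in> poly_space (n - 1)"
    and lin: "\<And>c. (\<Sum>i<n. smult (c i) (f i)) = 0 \<Longrightarrow> \<forall>i<n. c i = 0"
  shows "basis_family {..<n} f (poly_space (n - 1))"
proof -
  have inj: "inj_on f {..<n}"
  proof (rule inj_onI, rule ccontr)
    fix i j assume ij: "i \<in> {..<n}" "j \<in> {..<n}" "f i = f j" "i \<noteq> j"
    (* f i - f j is a vanishing combination with nonzero coefficients *)
    let ?c = "\<lambda>k. (if k = i then 1 else 0) - (if k = j then 1 else 0 :: real)"
    have "(\<Sum>k<n. smult (?c k) (f k)) =
        (\<Sum>k<n. if k = i then f k else 0) - (\<Sum>k<n. if k = j then f k else 0)"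
      unfolding sum_subtractf[symmetric] by (rule sum.cong) auto
    also have "\<dots> = 0" using ij by simp
    finally have "?c i = 0" using lin[of ?c] ij by blast
    then show False using ij by simp
  qed
  have indep: "rpoly.independent (f ` {..<n})"
  proof (rule rpoly.independent_if_scalars_zero)
    fix u x assume "(\<Sum>x\<in>f ` {..<n}. smult (u x) x) = 0" and x: "x \<in> f ` {..<n}"
    then have "(\<Sum>i<n. smult (u (f i)) (f i)) = 0"
      by (simp add: sum.reindex[OF inj])
    then show "u x = 0" using lin[of "\<lambda>i. u (f i)"] x by auto
  qed simp
  have "rpoly.span (f ` {..<n}) \<subseteq> poly_space (n - 1)"
    using f by (intro rpoly.span_minimal subspace_poly_space) auto
  moreover have "poly_space (n - 1) \<subseteq> rpoly.span (f ` {..<n})"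
  proof (rule ccontr)
    assume "\<not> ?thesis"
    then obtain q where q: "q \<in> poly_space (n - 1)" "q \<notin> rpoly.span (f ` {..<n})" by blast
    have card_le: "card (insert q (f ` {..<n})) \<le> card (monom (1::real) ` {..n - 1})"
    proof (rule conjunct2[OF rpoly.independent_span_bound])
      show "rpoly.independent (insert q (f ` {..<n}))"
        using q(2) indep by (rule rpoly.independent_insertI)
      show "insert q (f ` {..<n}) \<subseteq> rpoly.span (monom 1 ` {..n - 1})"
        using q(1) f poly_space_subset_span_monom[of "n - 1"] by blast
    qed simp
    have "q \<notin> f ` {..<n}" using q(2) rpoly.span_superset by (rule contra_subsetD[rotated])
    then have "card (insert q (f ` {..<n})) = Suc n" using card_image[OF inj] by simp
    moreover have "card (monom (1::real) ` {..n - 1}) \<le> n"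
      using card_image_le[of "{..n - 1}" "monom (1::real)"] n by simp
    ultimately show False using card_le by linarith
  qed
  ultimately have "rpoly.span (f ` {..<n}) = poly_space (n - 1)" by (rule subset_antisym)
  then show ?thesis using inj indep by (simp only: basis_family_def simp_thms)
qed

section \<open>Hermite conditions as divisibility\<close>

text \<open>
  In characteristic zero, differentiation lowers the multiplicity of a root by exactly one.
\<close>

lemma higher_pderiv_zero_iff_power_dvd:
  fixes q :: "'a::field_char_0 poly"
  shows "(\<forall>r<m. poly ((pderiv ^^ r) q) a = 0) \<longleftrightarrow> [:-a, 1:] ^ m dvd q"
proof (induction m arbitrary: q)
  case 0
  show ?case by simp
next
  case (Suc m)
  have "(\<forall>r<Suc m. poly ((pderiv ^^ r) q) a = 0) \<longleftrightarrow>
      poly q a = 0 \<and> (\<forall>r<m. poly ((pderiv ^^ r) (pderiv q)) a = 0)"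
    by (simp add: All_less_Suc2 funpow_Suc_right del: funpow.simps(2))
  also have "\<dots> \<longleftrightarrow> poly q a = 0 \<and> [:-a, 1:] ^ m dvd pderiv q"
    by (simp only: Suc.IH)
  also have "\<dots> \<longleftrightarrow> [:-a, 1:] ^ Suc m dvd q"
  proof (cases "q = 0 \<or> poly q a \<noteq> 0")
    case True
    then show ?thesis by (auto simp: order_divides order_root simp del: power_Suc)
  next
    case False
    have "pderiv q \<noteq> 0"
    proof
      assume "pderiv q = 0"
      then obtain b where "q = [:b:]" by (auto simp: pderiv_eq_0_iff elim: degree_eq_zeroE)
      then show False using False by auto
    qed
    then show ?thesis
      using False order_pderiv[of q a] by (auto simp: order_divides simp del: power_Suc)
  qed
  finally show ?case .
qed

lemma linear_power_dvd_mult_cancel: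
  fixes u s :: "'a::idom poly"
  assumes "poly u a \<noteq> 0"
  shows "[:-a, 1:] ^ m dvd u * s \<longleftrightarrow> [:-a, 1:] ^ m dvd s"
proof (cases "s = 0")
  case False
  moreover have "u \<noteq> 0" using assms by auto
  ultimately have "order a (u * s) = order a s"
    using assms by (simp add: order_mult order_0I)
  then show ?thesis using False \<open>u \<noteq> 0\<close> by (simp add: order_divides)
qed simp

lemma one_minus_X_power: "[:1, -1:] ^ m = smult ((- 1) ^ m) ([:-1, 1 :: real:] ^ m)"
  by (simp flip: smult_power)

lemma chi_dvd_iff:
  "chi p \<gamma>p \<gamma>m dvd D \<longleftrightarrow>
     (\<forall>r<2 * p. poly ((pderiv ^^ r) D) 0 = 0) \<and>
     (\<forall>r<\<gamma>p. poly ((pderiv ^^ r) D) 1 = 0) \<and>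
     (\<forall>r<\<gamma>m. poly ((pderiv ^^ r) D) (-1) = 0)"
proof -
  let ?a = "[:-0, 1::real:] ^ (2 * p)" and ?b = "[:-1, 1::real:] ^ \<gamma>p"
    and ?c = "[:-(-1), 1::real:] ^ \<gamma>m"
  have chi: "chi p \<gamma>p \<gamma>m = smult ((- 1) ^ \<gamma>p) (?a * ?b * ?c)"
    by (simp add: chi_def one_minus_X_power)
  have "?a * ?b * ?c dvd D" if "?a dvd D" "?b dvd D" "?c dvd D"
  proof -
    obtain s where s: "D = ?a * s" using \<open>?a dvd D\<close> by (elim dvdE)
    have "?b dvd s"
      using \<open>?b dvd D\<close> unfolding s by (subst (asm) linear_power_dvd_mult_cancel) auto
    then obtain t where t: "s = ?b * t" by (elim dvdE)
    have st: "D = (?a * ?b) * t" by (simp only: s t mult.assoc)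
    have "?c dvd t"
      using \<open>?c dvd D\<close> unfolding st by (subst (asm) linear_power_dvd_mult_cancel) auto
    then show ?thesis unfolding st by (intro mult_dvd_mono) auto
  qed
  moreover have "?a dvd D" "?b dvd D" "?c dvd D" if "?a * ?b * ?c dvd D"
    using that by (meson dvd_mult_left dvd_mult_right)+
  ultimately have "chi p \<gamma>p \<gamma>m dvd D \<longleftrightarrow> ?a dvd D \<and> ?b dvd D \<and> ?c dvd D"
    unfolding chi by (subst smult_dvd_iff) auto
  then show ?thesis by (simp only: higher_pderiv_zero_iff_power_dvd)
qed

lemma chi_nonzero: "chi p \<gamma>p \<gamma>m \<noteq> 0"
  by (simp add: chi_def)

lemma degree_chi: "degree (chi p \<gamma>p \<gamma>m) = 2 * p + \<gamma>p + \<gamma>m"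
  by (simp add: chi_def degree_mult_eq degree_power_eq)

lemma chi_nonneg: "x \<in> {-1<..<1} \<Longrightarrow> poly (chi p \<gamma>p \<gamma>m) x \<ge> 0"
  by (simp add: chi_def power_mult)

section \<open>Jacobi polynomials and nonnegative weights\<close>

context
  fixes \<alpha> \<beta> :: real
  assumes \<alpha>: "\<alpha> > -1" and \<beta>: "\<beta> > -1"
begin

abbreviation (input) inner where "inner \<equiv> jacobi_inner \<alpha> \<beta>"
abbreviation (input) J where "J \<equiv> jacobi_poly \<alpha> \<beta>"

lemma jacobi_inner_zero_left: "inner 0 q = 0"
  by (simp add: jacobi_inner_def)

lemma jacobi_inner_sum_left: "inner (\<Sum>i\<in>I. f i) q = (\<Sum>i\<in>I. inner (f i) q)"
  by (induction I rule: infinite_finite_induct)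
    (simp_all add: jacobi_inner_zero_left jacobi_inner_add_left[OF \<alpha> \<beta>])

lemma degree_jacobi_poly: "degree (J n) = n"
  using is_jacobi_jacobi_poly[OF \<alpha> \<beta>] by (auto simp: is_jacobi_def)

lemma jacobi_poly_orthogonal_low: "degree q < n \<Longrightarrow> inner (J n) q = 0"
  using is_jacobi_jacobi_poly[OF \<alpha> \<beta>] by (auto simp: is_jacobi_def)

lemma jacobi_poly_nonzero: "J n \<noteq> 0"
proof
  assume "J n = 0"
  moreover have "poly (J n) 1 = pochhammer (\<alpha> + 1) n / fact n"
    using is_jacobi_jacobi_poly[OF \<alpha> \<beta>] by (simp add: is_jacobi_def)
  moreover have "pochhammer (\<alpha> + 1) n > 0" using \<alpha> by (simp add: pochhammer_pos)
  ultimately show False by simp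
qed

lemma jacobi_poly_0: "J 0 = 1"
proof -
  obtain b where b: "J 0 = [:b:]" using degree_jacobi_poly[of 0] by (auto elim: degree_eq_zeroE)
  moreover have "poly (J 0) 1 = 1"
    using is_jacobi_jacobi_poly[OF \<alpha> \<beta>, of 0] by (simp add: is_jacobi_def)
  ultimately show ?thesis by (simp add: one_pCons)
qed

lemma jacobi_poly_orthogonal: "j \<noteq> k \<Longrightarrow> inner (J k) (J j) = 0"
  using jacobi_poly_orthogonal_low[of "J j" k] jacobi_poly_orthogonal_low[of "J k" j]
  by (cases j k rule: linorder_cases) (auto simp: degree_jacobi_poly jacobi_inner_commute)

lemma jacobi_poly_inner_self: "inner (J k) (J k) \<noteq> 0"
  using jacobi_inner_self_eq_0[OF \<alpha> \<beta>] jacobi_poly_nonzero by blast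

text \<open>
  The integrand \<open>g q\<^sup>2\<close> is nonnegative, so its weighted integral vanishes only if \<open>g q\<^sup>2 = 0\<close>.
\<close>

lemma weighted_inner_definite:
  assumes g: "g \<noteq> 0" "\<And>x. x \<in> {-1<..<1} \<Longrightarrow> poly g x \<ge> 0" and "inner (g * q) q = 0"
  shows "q = 0"
proof -
  have "g * q * q = 0"
  proof (rule jacobi_weight_integral_eq_0[OF \<alpha> \<beta>])
    show "poly (g * q * q) x \<ge> 0" if "x \<in> {-1<..<1}" for x
      using g(2)[OF that] by (simp add: mult.assoc)
  qed (use assms(3) in \<open>simp add: jacobi_inner_eq\<close>)
  then show ?thesis using g(1) by simp
qed

text \<open>
  In a vanishing linear combination, pairing with \<open>J 0\<close> leaves only the first coefficient; this
  coefficient is therefore zero, pairing with \<open>J 1\<close> then leaves only the second one, and so on.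
\<close>

lemma triangular_coeffs_zero:
  assumes tri: "\<And>j k. j < k \<Longrightarrow> k < n \<Longrightarrow> inner (g * f k) (J j) = 0"
    and diag: "\<And>k. k < n \<Longrightarrow> inner (g * f k) (J k) \<noteq> 0"
    and sum: "(\<Sum>k<n. smult (c k) (f k)) = 0" and "i < n"
  shows "c i = 0"
  using \<open>i < n\<close>
proof (induction i rule: less_induct)
  case (less i)
  have "0 = inner (g * (\<Sum>k<n. smult (c k) (f k))) (J i)"
    by (simp add: sum jacobi_inner_zero_left)
  also have "\<dots> = (\<Sum>k<n. c k * inner (g * f k) (J i))"
    by (simp add: sum_distrib_left jacobi_inner_sum_left jacobi_inner_smult_left)
  also have "\<dots> = (\<Sum>k<n. if k = i then c i * inner (g * f i) (J i) else 0)"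
  proof (rule sum.cong[OF refl])
    fix k assume "k \<in> {..<n}"
    then show "c k * inner (g * f k) (J i) = (if k = i then c i * inner (g * f i) (J i) else 0)"
      using less.IH[of k] tri[of i k] by (cases i k rule: linorder_cases) auto
  qed
  also have "\<dots> = c i * inner (g * f i) (J i)" using less.prems by simp
  finally show "c i = 0" using diag[OF less.prems] by simp
qed

lemma basis_family_triangular:
  assumes "0 < n" "\<And>k. k < n \<Longrightarrow> f k \<in> poly_space (n - 1)"
    and "\<And>j k. j < k \<Longrightarrow> k < n \<Longrightarrow> inner (g * f k) (J j) = 0"
    and "\<And>k. k < n \<Longrightarrow> inner (g * f k) (J k) \<noteq> 0"
  shows "basis_family {..<n} f (poly_space (n - 1))"
proof (rule basis_familyI)
  fix c assume "(\<Sum>k<n. smult (c k) (f k)) = 0"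
  then show "\<forall>i<n. c i = 0"
    using triangular_coeffs_zero[of n g f c] assms(3,4) by blast
qed (fact assms(1,2))+

lemma jacobi_poly_independent:
  assumes "(\<Sum>k<n. smult (c k) (J k)) = 0" "i < n"
  shows "c i = 0"
proof (rule triangular_coeffs_zero[of n 1 J c])
  show "inner (1 * J k) (J j) = 0" if "j < k" for j k
    using that jacobi_poly_orthogonal[of j k] by simp
  show "inner (1 * J k) (J k) \<noteq> 0" for k
    using jacobi_poly_inner_self[of k] by simp
qed (fact assms)+

section \<open>The complement of the span of high Jacobi polynomials\<close>

lemma jacobi_span_orthogonal:
  assumes "C \<in> jacobi_span \<alpha> \<beta> N d" "degree q < N"
  shows "inner C q = 0"
  using assms(1) unfolding jacobi_span_def
proof (induction rule: rpoly.span_induct_alt)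
  case (step c x y)
  then have "inner x q = 0" using assms(2) by (auto intro: jacobi_poly_orthogonal_low)
  then show ?case using step
    by (simp add: jacobi_inner_add_left[OF \<alpha> \<beta>] jacobi_inner_smult_left)
qed (rule jacobi_inner_zero_left)

lemma jacobi_span_subset: "jacobi_span \<alpha> \<beta> N d \<subseteq> poly_space (N + d - 1)"
  unfolding jacobi_span_def
  by (intro rpoly.span_minimal subspace_poly_space)
    (auto simp: poly_space_def degree_jacobi_poly)

lemma jacobi_span_weighted_trivial:
  assumes g: "g \<noteq> 0" "\<And>x. x \<in> {-1<..<1} \<Longrightarrow> poly g x \<ge> 0"
    and "g * q \<in> jacobi_span \<alpha> \<beta> N d" "degree q < N"
  shows "q = 0"
  using weighted_inner_definite[OF g] jacobi_span_orthogonal[OF assms(3,4)] by blast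

text \<open>
  The products of \<open>g\<close> with the low Jacobi polynomials, together with the high Jacobi polynomials,
  are as many as the dimension of the whole space; by the trivial intersection they are
  independent, hence a basis.
\<close>

lemma jacobi_span_decomposition:
  assumes g: "g \<noteq> 0" "\<And>x. x \<in> {-1<..<1} \<Longrightarrow> poly g x \<ge> 0"
    and N: "0 < N" and d: "degree g = d" and f: "f \<in> poly_space (N + d - 1)"
  obtains C q where "C \<in> jacobi_span \<alpha> \<beta> N d" "degree q < N" "f = C + g * q"
proof -
  define h where "h i = (if i < N then g * J i else J i)" for i
  have split: "{..<N + d} = {..<N} \<union> {N..<N + d}" by auto
  have range: "{N..<N + d} \<subseteq> {N..N + d - 1}" using N by auto
  have degree_low: "degree q < N" if "q \<in> poly_space (N - 1)" for q
    using that N by (auto simp: poly_space_def)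
  have low: "(\<Sum>i<N. smult (c i) (J i)) \<in> poly_space (N - 1)" for c
    by (intro rpoly.subspace_sum rpoly.subspace_scale subspace_poly_space)
      (auto simp: poly_space_def degree_jacobi_poly)
  have high: "(\<Sum>i=N..<N + d. smult (c i) (J i)) \<in> jacobi_span \<alpha> \<beta> N d" for c
    using range unfolding jacobi_span_def
    by (intro rpoly.span_sum rpoly.span_scale rpoly.span_base) auto
  have sum_h: "(\<Sum>i<N + d. smult (c i) (h i)) =
      g * (\<Sum>i<N. smult (c i) (J i)) + (\<Sum>i=N..<N + d. smult (c i) (J i))" for c
    unfolding split by (subst sum.union_disjoint) (auto simp: h_def sum_distrib_left)
  have "basis_family {..<N + d} h (poly_space (N + d - 1))"
  proof (rule basis_familyI)
    show "0 < N + d" using N by simp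
    show "h i \<in> poly_space (N + d - 1)" if "i < N + d" for i
      using that degree_mult_le[of g "J i"]
      by (auto simp: h_def poly_space_def degree_jacobi_poly d)
  next
    fix c assume c: "(\<Sum>i<N + d. smult (c i) (h i)) = 0"
    let ?q = "\<Sum>i<N. smult (c i) (J i)" and ?r = "\<Sum>i=N..<N + d. smult (c i) (J i)"
    have sum0: "g * ?q + ?r = 0" using c by (simp only: sum_h)
    then have "g * ?q = - ?r" by (simp only: eq_neg_iff_add_eq_0)
    also have "\<dots> \<in> jacobi_span \<alpha> \<beta> N d"
      using high[of c] unfolding jacobi_span_def by (rule rpoly.span_neg)
    finally have "?q = 0"
      using jacobi_span_weighted_trivial[OF g] degree_low[OF low] by blast
    moreover from this have "?r = 0" using sum0 by simp
    ultimately have "(\<Sum>i<N + d. smult (c i) (J i)) = 0"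
      unfolding split by (subst sum.union_disjoint) auto
    then show "\<forall>i<N + d. c i = 0" using jacobi_poly_independent by blast
  qed
  then have span_h: "f \<in> rpoly.span (h ` {..<N + d})" and inj: "inj_on h {..<N + d}"
    using f by (auto simp: basis_family_def)
  then obtain u where "f = (\<Sum>v\<in>h ` {..<N + d}. smult (u v) v)"
    by (auto simp: rpoly.span_finite)
  also have "\<dots> = (\<Sum>i<N + d. smult (u (h i)) (h i))"
    by (simp add: sum.reindex[OF inj])
  finally have "f = (\<Sum>i=N..<N + d. smult (u (h i)) (J i)) +
      g * (\<Sum>i<N. smult (u (h i)) (J i))"
    by (simp only: sum_h[of "\<lambda>i. u (h i)"] add.commute)
  then show thesis by (rule that[OF high[of "\<lambda>i. u (h i)"] degree_low[OF low[of "\<lambda>i. u (h i)"]]])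
qed

section \<open>The interpolants and their quotients\<close>

lemma is_C_tilde_iff:
  "is_C_tilde \<alpha> \<beta> N p \<gamma>p \<gamma>m k C \<longleftrightarrow>
     C \<in> jacobi_span \<alpha> \<beta> N (2 * p + \<gamma>p + \<gamma>m) \<and> chi p \<gamma>p \<gamma>m dvd C - J k"
  by (simp add: is_C_tilde_def chi_dvd_iff)

lemma degree_chi_quotient:
  assumes "0 < N" "chi p \<gamma>p \<gamma>m * q \<in> poly_space (N + (2 * p + \<gamma>p + \<gamma>m) - 1)"
  shows "degree q < N"
  using assms chi_nonzero[of p \<gamma>p \<gamma>m]
  by (cases "q = 0") (auto simp: poly_space_def degree_mult_eq degree_chi)

text \<open>
  The difference of two solutions lies in the span of the high Jacobi polynomials and is a multiple
  \<open>\<chi> q\<close>; its degree forces \<open>q\<close> to have degree below \<open>N\<close>, where the intersection is trivial.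
\<close>

lemma is_C_tilde_ex1:
  assumes N: "0 < N" and k: "k < N"
  shows "\<exists>!C. is_C_tilde \<alpha> \<beta> N p \<gamma>p \<gamma>m k C"
proof -
  let ?d = "2 * p + \<gamma>p + \<gamma>m"
  have "J k \<in> poly_space (N + ?d - 1)"
    using k by (simp add: poly_space_def degree_jacobi_poly)
  then obtain C q where C: "C \<in> jacobi_span \<alpha> \<beta> N ?d" "J k = C + chi p \<gamma>p \<gamma>m * q"
    using jacobi_span_decomposition[OF chi_nonzero chi_nonneg N degree_chi] by metis
  have "C - J k = chi p \<gamma>p \<gamma>m * (- q)" using C(2) by simp
  then have "is_C_tilde \<alpha> \<beta> N p \<gamma>p \<gamma>m k C"
    unfolding is_C_tilde_iff using C(1) by (metis dvd_triv_left)
  moreover have "A = B"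
    if "is_C_tilde \<alpha> \<beta> N p \<gamma>p \<gamma>m k A" "is_C_tilde \<alpha> \<beta> N p \<gamma>p \<gamma>m k B" for A B
  proof -
    have "chi p \<gamma>p \<gamma>m dvd (A - J k) - (B - J k)"
      by (rule dvd_diff) (use that in \<open>auto simp only: is_C_tilde_iff\<close>)
    then obtain q where q: "A - B = chi p \<gamma>p \<gamma>m * q" by (auto elim: dvdE)
    have "A - B \<in> jacobi_span \<alpha> \<beta> N ?d"
      using that unfolding is_C_tilde_iff jacobi_span_def by (auto intro: rpoly.span_diff)
    then have AB: "chi p \<gamma>p \<gamma>m * q \<in> jacobi_span \<alpha> \<beta> N ?d" by (simp only: q)
    then have "degree q < N" using degree_chi_quotient[OF N] jacobi_span_subset by blast
    then have "q = 0" using jacobi_span_weighted_trivial[OF chi_nonzero chi_nonneg AB] by blast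
    then show "A = B" using q by simp
  qed
  ultimately show ?thesis by blast
qed

lemma Q_tilde_properties:
  assumes N: "0 < N" and k: "k < N"
  shows chi_dvd_C_tilde: "chi p \<gamma>p \<gamma>m dvd C_tilde \<alpha> \<beta> N p \<gamma>p \<gamma>m k - J k"
    and Q_tilde_in_poly_space: "Q_tilde \<alpha> \<beta> N p \<gamma>p \<gamma>m k \<in> poly_space (N - 1)"
    and inner_chi_Q_tilde: "j < N \<Longrightarrow>
      inner (chi p \<gamma>p \<gamma>m * Q_tilde \<alpha> \<beta> N p \<gamma>p \<gamma>m k) (J j) = - inner (J k) (J j)"
proof -
  let ?d = "2 * p + \<gamma>p + \<gamma>m"
  let ?C = "C_tilde \<alpha> \<beta> N p \<gamma>p \<gamma>m k" and ?Q = "Q_tilde \<alpha> \<beta> N p \<gamma>p \<gamma>m k"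
  have "is_C_tilde \<alpha> \<beta> N p \<gamma>p \<gamma>m k ?C"
    unfolding C_tilde_def by (rule theI'[OF is_C_tilde_ex1[OF N k]])
  then have C: "?C \<in> jacobi_span \<alpha> \<beta> N ?d" and dvd: "chi p \<gamma>p \<gamma>m dvd ?C - J k"
    by (auto simp: is_C_tilde_iff)
  then have Q: "chi p \<gamma>p \<gamma>m * ?Q = ?C - J k" by (simp add: Q_tilde_def)
  show "chi p \<gamma>p \<gamma>m dvd ?C - J k" by (rule dvd)
  have "?C - J k \<in> poly_space (N + ?d - 1)"
    using C jacobi_span_subset k
    by (intro rpoly.subspace_diff subspace_poly_space)
      (auto simp: poly_space_def degree_jacobi_poly)
  then have "degree ?Q < N" unfolding Q[symmetric] by (rule degree_chi_quotient[OF N])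
  then show "?Q \<in> poly_space (N - 1)" by (simp add: poly_space_def)
  show "inner (chi p \<gamma>p \<gamma>m * ?Q) (J j) = - inner (J k) (J j)" if "j < N"
    using jacobi_span_orthogonal[OF C, of "J j"] that
    by (simp add: Q jacobi_inner_diff_left[OF \<alpha> \<beta>] degree_jacobi_poly)
qed

end

theorem lemma5:
  fixes \<alpha> \<beta> :: real and N p \<gamma>p \<gamma>m :: nat
  assumes "\<alpha> > -1" and "\<beta> > -1" and "N \<ge> 1" and "2 * p + \<gamma>p + \<gamma>m \<ge> 1"
  shows "(\<forall>k<N. \<exists>!C. is_C_tilde \<alpha> \<beta> N p \<gamma>p \<gamma>m k C) \<and>
    (\<forall>k<N. chi p \<gamma>p \<gamma>m dvd C_tilde \<alpha> \<beta> N p \<gamma>p \<gamma>m k - jacobi_poly \<alpha> \<beta> k \<and>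
           Q_tilde \<alpha> \<beta> N p \<gamma>p \<gamma>m k \<in> poly_space (N - 1)) \<and>
    basis_family {..<N} (Q_tilde \<alpha> \<beta> N p \<gamma>p \<gamma>m) (poly_space (N - 1)) \<and>
    basis_family {..<N} (\<lambda>k. if k = 0 then 1 else Q_tilde \<alpha> \<beta> N p \<gamma>p \<gamma>m k)
      (poly_space (N - 1))"
proof -
  have N: "0 < N" using assms(3) by simp
  note ab = assms(1,2)
  let ?Q = "Q_tilde \<alpha> \<beta> N p \<gamma>p \<gamma>m" and ?chi = "chi p \<gamma>p \<gamma>m"
  note Q_space = Q_tilde_in_poly_space[OF ab N]
  have off: "jacobi_inner \<alpha> \<beta> (?chi * ?Q k) (jacobi_poly \<alpha> \<beta> j) = 0" if "j < k" "k < N" for j k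
    using that jacobi_poly_orthogonal[OF ab, of j k] by (simp add: inner_chi_Q_tilde[OF ab N])
  have diag: "jacobi_inner \<alpha> \<beta> (?chi * ?Q k) (jacobi_poly \<alpha> \<beta> k) \<noteq> 0" if "k < N" for k
    using that jacobi_poly_inner_self[OF ab] by (simp add: inner_chi_Q_tilde[OF ab N])
  have chi_one: "jacobi_inner \<alpha> \<beta> (?chi * 1) (jacobi_poly \<alpha> \<beta> 0) \<noteq> 0"
    using weighted_inner_definite[OF ab chi_nonzero chi_nonneg, of p \<gamma>p \<gamma>m 1]
    by (auto simp: jacobi_poly_0[OF ab])
  have B1: "basis_family {..<N} ?Q (poly_space (N - 1))"
    by (rule basis_family_triangular[OF ab N, of ?Q ?chi]) (fact Q_space off diag)+
  have B2: "basis_family {..<N} (\<lambda>k. if k = 0 then 1 else ?Q k) (poly_space (N - 1))"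
  proof (rule basis_family_triangular[OF ab N, where g = ?chi])
    show "(if k = 0 then 1 else ?Q k) \<in> poly_space (N - 1)" if "k < N" for k
      using Q_space that by (simp add: poly_space_def)
  qed (use off diag chi_one in auto)
  show ?thesis
    using is_C_tilde_ex1[OF ab N] chi_dvd_C_tilde[OF ab N] Q_space B1 B2 by blast
qed

end
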